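(* Let $(\mathbf X,\mathbf Y)=(X_1,X_2,Y_1,Y_2)$ and $(\mathbf X^\ast,\mathbf Y^\ast)=(X_1^\ast,X_2^\ast,Y_1^\ast,Y_2^\ast)$ be random vectors in $\mathbb R^4$ with probability densities $f$ and $f^\ast$, respectively, where $$\begin{aligned} f(x_1,x_2,y_1,y_2)=\;&1_{\{0\le x_1\le x_2\le 1\}}1_{\{1<y_1\le y_2\le 2\}}+1_{\{0\le x_2<x_1\le 1\}}1_{\{1<y_2<y_1\le 2\}}\\&+1_{\{1<x_1\le x_2\le 2\}}1_{\{0\le y_1\le y_2\le 1\}}+1_{\{1<x_2<x_1\le 2\}}1_{\{0\le y_2<y_1\le 1\}},\\ f^\ast(x_1,x_2,y_1,y_2)=\;&1_{\{0\le x_1\le x_2\le 1\}}1_{\{0\le y_2<y_1\le 1\}}+1_{\{0\le x_2<x_1\le 1\}}1_{\{1<y_2<y_1\le 2\}}\\&+1_{\{1<x_1\le x_2\le 2\}}1_{\{0\le y_1\le y_2\le 1\}}+1_{\{1<x_2<x_1\le 2\}}1_{\{1<y_1\le y_2\le 2\}}.\end{aligned}$$ Then $\mathbf X\overset{D}{=}\mathbf X^\ast$, $\mathbf Y\overset{D}{=}\mathbf Y^\ast$, $X_1\overset{D}{=}X_2$, $Y_1\overset{D}{=}Y_2$ (equalities in distribution), and $(\mathbf X,\mathbf Y)\preccurlyeq_C(\mathbf X^\ast,\mathbf Y^\ast)$ in concordance ordering, but $$\Pr(\Pi(\mathbf X)=\Pi(\mathbf Y))=1>\tfrac12=\Pr(\Pi(\mathbf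 X^\ast)=\Pi(\mathbf Y^\ast))\quad\text{and}\quad \operatorname{OPD}_2(\mathbf X,\mathbf Y)>\operatorname{OPD}_2(\mathbf X^\ast,\mathbf Y^\ast).$$ In particular, ordinal pattern dependence does not respect concordance ordering: it is not true that, for all pairs of random vectors with $\mathbf X\overset{D}{=}\mathbf X^\ast$ and $\mathbf Y\overset{D}{=}\mathbf Y^\ast$, $(\mathbf X,\mathbf Y)\preccurlyeq_C(\mathbf X^\ast,\mathbf Y^\ast)$ implies $\operatorname{OPD}_2(\mathbf X,\mathbf Y)\le\operatorname{OPD}_2(\mathbf X^\ast,\mathbf Y^\ast)$.
   Context: Ordinal pattern: let $S_d$ be the set of permutations of $\{1,\dots,d\}$. For $\mathbf x=(x_1,\dots,x_d)\in\mathbb R^d$, $\Pi(\mathbf x)\in S_d$ is the permutation $\pi=(\pi_1,\dots,\pi_d)$ satisfying, for all $i,j\in\{1,\dots,d\}$, $\pi_i<\pi_j \Leftrightarrow x_i<x_j$ or ($x_i=x_j$ and $i<j$). Ordinal pattern dependence of two $d$-dimensional random vectors: $$\operatorname{OPD}_d(\mathbf X,\mathbf Y):=\frac{\Pr(\Pi(\mathbf X)=\Pi(\mathbf Y))-\sum_{\pi\in S_d}\Pr(\Pi(\mathbf X)=\pi)\Pr(\Pi(\mathbf Y)=\pi)}{1-\sum_{\pi\in S_d}\Pr(\Pi(\mathbf X)=\pi)\Pr(\Pi(\mathbf Y)=\pi)}.$$ For a random vector $\mathbf U$ in $\mathbb R^m$: $F_{\mathbf U}(\mathbf u)=\Pr(U_1\le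 u_1,\dots,U_m\le u_m)$ and $\overline F_{\mathbf U}(\mathbf u)=\Pr(U_1\ge u_1,\dots,U_m\ge u_m)$. Concordance ordering: $(\mathbf X,\mathbf Y)\preccurlyeq_C(\mathbf X^\ast,\mathbf Y^\ast)$ if and only if $F_{(\mathbf X,\mathbf Y)}\le F_{(\mathbf X^\ast,\mathbf Y^\ast)}$ and $\overline F_{(\mathbf X,\mathbf Y)}\le\overline F_{(\mathbf X^\ast,\mathbf Y^\ast)}$ pointwise on $\mathbb R^{2d}$ (here $d=2$). $1_{\{\cdot\}}$ denotes the indicator function. *)

theory Defs
  imports "HOL-Probability.Probability" "HOL-Combinatorics.Permutations"
begin

(* Points of R^d are functions on the index set {1..d}, as in the library's product spaces PiM. *)
abbreviation euclidean_borel :: "nat \<Rightarrow> (nat \<Rightarrow> real) measure" where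
  "euclidean_borel d \<equiv> (\<Pi>\<^sub>M i\<in>{1..d}. borel)"

abbreviation random_vector :: "nat \<Rightarrow> 'a measure \<Rightarrow> ('a \<Rightarrow> nat \<Rightarrow> real) \<Rightarrow> bool" where
  "random_vector d M X \<equiv> X \<in> M \<rightarrow>\<^sub>M euclidean_borel d"

definition ordinal_pattern :: "nat \<Rightarrow> (nat \<Rightarrow> real) \<Rightarrow> nat \<Rightarrow> nat" where
  "ordinal_pattern d x =
    (THE \<pi>. \<pi> permutes {1..d} \<and>
      (\<forall>i\<in>{1..d}. \<forall>j\<in>{1..d}. \<pi> i < \<pi> j \<longleftrightarrow> x i < x j \<or> (x i = x j \<and> i < j)))"

definition pattern_product_sum ::
  "nat \<Rightarrow> 'a measure \<Rightarrow> ('a \<Rightarrow> nat \<Rightarrow> real) \<Rightarrow> ('a \<Rightarrow> nat \<Rightarrow> real) \<Rightarrow> real" where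
  "pattern_product_sum d M X Y =
    (\<Sum>\<pi> | \<pi> permutes {1..d}.
      \<P>(\<omega> in M. ordinal_pattern d (X \<omega>) = \<pi>) * \<P>(\<omega> in M. ordinal_pattern d (Y \<omega>) = \<pi>))"

(* The quotient is undefined in the mathematics when the denominator vanishes; here it is then 0.
   The denominator depends only on the laws of X and of Y separately, and when it vanishes so does
   the numerator. *)
definition opd ::
  "nat \<Rightarrow> 'a measure \<Rightarrow> ('a \<Rightarrow> nat \<Rightarrow> real) \<Rightarrow> ('a \<Rightarrow> nat \<Rightarrow> real) \<Rightarrow> real" where
  "opd d M X Y =
    (\<P>(\<omega> in M. ordinal_pattern d (X \<omega>) = ordinal_pattern d (Y \<omega>)) - pattern_product_sum d M X Y)
      / (1 - pattern_product_sum d M X Y)"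

(* Distribution function and survival function of the 2d-dimensional vector (X, Y) at the
   point (x, y). *)
definition joint_cdf ::
  "nat \<Rightarrow> 'a measure \<Rightarrow> ('a \<Rightarrow> nat \<Rightarrow> real) \<Rightarrow> ('a \<Rightarrow> nat \<Rightarrow> real)
    \<Rightarrow> (nat \<Rightarrow> real) \<Rightarrow> (nat \<Rightarrow> real) \<Rightarrow> real" where
  "joint_cdf d M X Y x y =
    \<P>(\<omega> in M. (\<forall>i\<in>{1..d}. X \<omega> i \<le> x i) \<and> (\<forall>i\<in>{1..d}. Y \<omega> i \<le> y i))"

definition joint_survival ::
  "nat \<Rightarrow> 'a measure \<Rightarrow> ('a \<Rightarrow> nat \<Rightarrow> real) \<Rightarrow> ('a \<Rightarrow> nat \<Rightarrow> real)
    \<Rightarrow> (nat \<Rightarrow> real) \<Rightarrow> (nat \<Rightarrow> real) \<Rightarrow> real" where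
  "joint_survival d M X Y x y =
    \<P>(\<omega> in M. (\<forall>i\<in>{1..d}. X \<omega> i \<ge> x i) \<and> (\<forall>i\<in>{1..d}. Y \<omega> i \<ge> y i))"

definition concordance_le ::
  "nat \<Rightarrow> 'a measure \<Rightarrow> ('a \<Rightarrow> nat \<Rightarrow> real) \<Rightarrow> ('a \<Rightarrow> nat \<Rightarrow> real)
    \<Rightarrow> 'b measure \<Rightarrow> ('b \<Rightarrow> nat \<Rightarrow> real) \<Rightarrow> ('b \<Rightarrow> nat \<Rightarrow> real) \<Rightarrow> bool" where
  "concordance_le d M X Y N X' Y' \<longleftrightarrow>
    (\<forall>x y. joint_cdf d M X Y x y \<le> joint_cdf d N X' Y' x y \<and>
           joint_survival d M X Y x y \<le> joint_survival d N X' Y' x y)"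

definition dens :: "real \<times> real \<times> real \<times> real \<Rightarrow> real" where
  "dens = (\<lambda>(x1, x2, y1, y2).
      of_bool (0 \<le> x1 \<and> x1 \<le> x2 \<and> x2 \<le> 1) * of_bool (1 < y1 \<and> y1 \<le> y2 \<and> y2 \<le> 2)
    + of_bool (0 \<le> x2 \<and> x2 < x1 \<and> x1 \<le> 1) * of_bool (1 < y2 \<and> y2 < y1 \<and> y1 \<le> 2)
    + of_bool (1 < x1 \<and> x1 \<le> x2 \<and> x2 \<le> 2) * of_bool (0 \<le> y1 \<and> y1 \<le> y2 \<and> y2 \<le> 1)
    + of_bool (1 < x2 \<and> x2 < x1 \<and> x1 \<le> 2) * of_bool (0 \<le> y2 \<and> y2 < y1 \<and> y1 \<le> 1))"

definition dens_star :: "real \<times> real \<times> real \<times> real \<Rightarrow> real" where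
  "dens_star = (\<lambda>(x1, x2, y1, y2).
      of_bool (0 \<le> x1 \<and> x1 \<le> x2 \<and> x2 \<le> 1) * of_bool (0 \<le> y2 \<and> y2 < y1 \<and> y1 \<le> 1)
    + of_bool (0 \<le> x2 \<and> x2 < x1 \<and> x1 \<le> 1) * of_bool (1 < y2 \<and> y2 < y1 \<and> y1 \<le> 2)
    + of_bool (1 < x1 \<and> x1 \<le> x2 \<and> x2 \<le> 2) * of_bool (0 \<le> y1 \<and> y1 \<le> y2 \<and> y2 \<le> 1)
    + of_bool (1 < x2 \<and> x2 < x1 \<and> x1 \<le> 2) * of_bool (1 < y1 \<and> y1 \<le> y2 \<and> y2 \<le> 2))"

end

(* Both densities are sums of four products T(x) T'(y), with T and T' indicators of the two
   triangles in [0,1]^2 and of the two in (1,2]^2, and every triangle has area 1/2; so the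
   probability of a product event is a sum of four products of areas. For orthants, with a, b the
   areas cut out of the triangles up0, dn0 and a', b' those cut out of up1, dn1, the difference of the
   two distribution functions is (a(x) - b'(x)) (b(y) - a'(y)). Both factors are nonnegative for
   lower orthants and nonpositive for upper ones, because an orthant that meets one square
   contains every triangle of the other square that lies on its unbounded side. The patterns agree
   in all four terms of the first density but only in the two middle terms of the second. *)
theory Submission
  imports Defs
begin

section \<open>Sums of product indicators on R^4 and their integrals over product sets\<close>

text \<open>The blocks form a list so that integrals can be computed by induction over it; the
  values lie in \<open>ennreal\<close>, the type that \<open>density\<close> expects.\<close>

definition block_density ::
  "((real \<times> real) set \<times> (real \<times> real) set) list \<Rightarrow> real \<times> real \<times> real \<times> real \<Rightarrow> ennreal" where
  "block_density ABs = (\<lambda>(x1, x2, y1, y2).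
     \<Sum>(A, B)\<leftarrow>ABs. indicator A (x1, x2) * indicator B (y1, y2))"

text \<open>Quadruples nest to the right, so \<open>(x1, x2)\<close> is not a component of the type
  and \<open>P \<times> Q\<close> would have another type; this set is that product after
  regrouping.\<close>

definition rect4 :: "(real \<times> real) set \<Rightarrow> (real \<times> real) set \<Rightarrow> (real \<times> real \<times> real \<times> real) set" where
  "rect4 P Q = {(x1, x2, y1, y2). (x1, x2) \<in> P \<and> (y1, y2) \<in> Q}"

lemma measurable_first_pair [measurable]:
  "(\<lambda>z :: real \<times> real \<times> real \<times> real. (fst z, fst (snd z))) \<in> borel \<rightarrow>\<^sub>M borel"
  by (intro borel_measurable_continuous_onI continuous_intros)

lemma rect4_sets [measurable]:
  assumes [measurable]: "P \<in> sets borel" "Q \<in> sets borel"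
  shows "rect4 P Q \<in> sets borel"
proof -
  have "rect4 P Q = {z \<in> space borel. (fst z, fst (snd z)) \<in> P \<and> snd (snd z) \<in> Q}"
    by (auto simp: rect4_def)
  also have "\<dots> \<in> sets borel"
  proof -
    have [measurable]: "(\<lambda>z :: real \<times> real \<times> real \<times> real. snd (snd z)) \<in> borel \<rightarrow>\<^sub>M borel"
      by (intro borel_measurable_continuous_onI continuous_intros)
    show ?thesis by measurable
  qed
  finally show ?thesis .
qed

text \<open>Tonelli twice: first \<open>x1\<close> is split from \<open>(x2, y1, y2)\<close>, then
  \<open>x2\<close> from \<open>(y1, y2)\<close>. The factor for \<open>Q\<close> comes out of both
  integrals, and the iterated integral that remains is the area of \<open>P\<close>.\<close>

lemma emeasure_rect4:
  assumes [measurable]: "P \<in> sets borel" "Q \<in> sets borel"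
  shows "emeasure lborel (rect4 P Q) = emeasure lborel P * emeasure lborel Q"
proof -
  have P [measurable]: "P \<in> sets (borel \<Otimes>\<^sub>M borel)" and Q [measurable]: "Q \<in> sets (borel \<Otimes>\<^sub>M borel)"
    using assms by (simp_all only: borel_prod)
  have [measurable]: "indicator (rect4 P Q) \<in>
      borel_measurable (lborel \<Otimes>\<^sub>M (lborel :: (real \<times> real \<times> real) measure))"
    by (simp add: lborel_prod)
  have inner: "(\<integral>\<^sup>+w. indicator (rect4 P Q) (x, w) \<partial>lborel)
      = (\<integral>\<^sup>+x2. indicator P (x, x2) \<partial>lborel) * emeasure lborel Q" for x
  proof -
    have "(\<integral>\<^sup>+w. indicator (rect4 P Q) (x, w) \<partial>lborel)
        = (\<integral>\<^sup>+w. indicator P (x, fst w) * indicator Q (snd w) \<partial>(lborel \<Otimes>\<^sub>M lborel))"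
      by (auto simp: lborel_prod rect4_def indicator_def intro!: nn_integral_cong)
    also have "\<dots> = (\<integral>\<^sup>+x2. \<integral>\<^sup>+y. indicator P (x, x2) * indicator Q y \<partial>lborel \<partial>lborel)"
      by (subst lborel.nn_integral_fst[symmetric]) auto
    also have "\<dots> = (\<integral>\<^sup>+x2. indicator P (x, x2) * emeasure lborel Q \<partial>lborel)"
      by (simp add: nn_integral_cmult)
    also have "\<dots> = (\<integral>\<^sup>+x2. indicator P (x, x2) \<partial>lborel) * emeasure lborel Q"
      by (rule nn_integral_multc) measurable
    finally show ?thesis .
  qed
  have "emeasure lborel (rect4 P Q) = (\<integral>\<^sup>+z. indicator (rect4 P Q) z \<partial>lborel)"
    by simp
  also have "\<dots> = (\<integral>\<^sup>+x. \<integral>\<^sup>+w. indicator (rect4 P Q) (x, w) \<partial>lborel \<partial>lborel)"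
    by (subst lborel.nn_integral_fst) (auto simp: lborel_prod)
  also have "\<dots> = (\<integral>\<^sup>+x. (\<integral>\<^sup>+x2. indicator P (x, x2) \<partial>lborel) * emeasure lborel Q \<partial>lborel)"
    by (simp only: inner)
  also have "\<dots> = (\<integral>\<^sup>+x. \<integral>\<^sup>+x2. indicator P (x, x2) \<partial>lborel \<partial>lborel) * emeasure lborel Q"
    by (rule nn_integral_multc) measurable
  also have "(\<integral>\<^sup>+x. \<integral>\<^sup>+x2. indicator P (x, x2) \<partial>lborel \<partial>lborel) = emeasure lborel P"
    by (subst lborel.nn_integral_fst) (auto simp: lborel_prod)
  finally show ?thesis .
qed

lemma block_density_eq:
  "block_density ABs z = (\<Sum>(A, B)\<leftarrow>ABs. indicator (rect4 A B) z)"
  unfolding block_density_def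
  by (cases z) (auto simp: rect4_def indicator_def intro!: arg_cong[where f = sum_list])

text \<open>The integral is additive over the list, and \<open>rect4 A B\<close> meets
  \<open>rect4 P Q\<close> in \<open>rect4 (A \<inter> P) (B \<inter> Q)\<close>. Measurability
  belongs to the same induction because splitting the integral requires it for the tail of the
  list.\<close>

lemma emeasure_block_density:
  assumes "\<And>A B. (A, B) \<in> set ABs \<Longrightarrow> A \<in> sets borel \<and> B \<in> sets borel"
    and P [measurable]: "P \<in> sets borel" and Q [measurable]: "Q \<in> sets borel"
  shows "block_density ABs \<in> borel_measurable borel"
    and "emeasure (density lborel (block_density ABs)) (rect4 P Q)
         = (\<Sum>(A, B)\<leftarrow>ABs. emeasure lborel (A \<inter> P) * emeasure lborel (B \<inter> Q))"
proof -
  have "block_density ABs \<in> borel_measurable borel \<and>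
      (\<integral>\<^sup>+z. block_density ABs z * indicator (rect4 P Q) z \<partial>lborel)
        = (\<Sum>(A, B)\<leftarrow>ABs. emeasure lborel (A \<inter> P) * emeasure lborel (B \<inter> Q))"
    using assms(1)
  proof (induction ABs)
    case Nil
    then show ?case by (simp add: block_density_eq[abs_def])
  next
    case (Cons AB ABs)
    obtain A B where AB: "AB = (A, B)" by force
    have [measurable]: "A \<in> sets borel" "B \<in> sets borel" "block_density ABs \<in> borel_measurable borel"
      using Cons AB by auto
    have split: "block_density (AB # ABs) = (\<lambda>z. indicator (rect4 A B) z + block_density ABs z)"
      by (simp add: block_density_eq[abs_def] AB)
    have "(\<integral>\<^sup>+z. block_density (AB # ABs) z * indicator (rect4 P Q) z \<partial>lborel)
       = (\<integral>\<^sup>+z. indicator (rect4 (A \<inter> P) (B \<inter> Q)) z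
            + block_density ABs z * indicator (rect4 P Q) z \<partial>lborel)"
      by (intro nn_integral_cong) (auto simp: split rect4_def indicator_def distrib_right)
    also have "\<dots> = emeasure lborel (rect4 (A \<inter> P) (B \<inter> Q))
        + (\<integral>\<^sup>+z. block_density ABs z * indicator (rect4 P Q) z \<partial>lborel)"
      by (subst nn_integral_add) auto
    finally have "(\<integral>\<^sup>+z. block_density (AB # ABs) z * indicator (rect4 P Q) z \<partial>lborel)
      = emeasure lborel (rect4 (A \<inter> P) (B \<inter> Q))
        + (\<integral>\<^sup>+z. block_density ABs z * indicator (rect4 P Q) z \<partial>lborel)" .
    moreover have "block_density (AB # ABs) \<in> borel_measurable borel"
      unfolding split by measurable
    ultimately show ?case
      using Cons by (auto simp: emeasure_rect4 AB)
  qed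
  then show "block_density ABs \<in> borel_measurable borel"
    and "emeasure (density lborel (block_density ABs)) (rect4 P Q)
         = (\<Sum>(A, B)\<leftarrow>ABs. emeasure lborel (A \<inter> P) * emeasure lborel (B \<inter> Q))"
    by (auto simp: emeasure_density)
qed

section \<open>The four triangles and their areas\<close>

text \<open>The digit is the lower left corner of the square. The diagonal belongs to the
  \<open>up\<close> triangles, in accordance with the tie rule of
  \<open>ordinal_pattern\<close>.\<close>

definition "up0 = {(u, v). 0 \<le> u \<and> u \<le> v \<and> v \<le> (1::real)}"
definition "dn0 = {(u, v). 0 \<le> v \<and> v < u \<and> u \<le> (1::real)}"
definition "up1 = {(u, v). 1 < u \<and> u \<le> v \<and> v \<le> (2::real)}"
definition "dn1 = {(u, v). 1 < v \<and> v < u \<and> u \<le> (2::real)}"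
lemmas triangle_defs = up0_def dn0_def up1_def dn1_def

lemma triangle_sets [measurable]:
  "up0 \<in> sets borel" "dn0 \<in> sets borel" "up1 \<in> sets borel" "dn1 \<in> sets borel"
proof -
  have "{p \<in> space (borel \<Otimes>\<^sub>M borel). 0 \<le> fst p \<and> fst p \<le> snd p \<and> snd p \<le> (1::real)} \<in> sets (borel \<Otimes>\<^sub>M borel)"
    "{p \<in> space (borel \<Otimes>\<^sub>M borel). 0 \<le> snd p \<and> snd p < fst p \<and> fst p \<le> (1::real)} \<in> sets (borel \<Otimes>\<^sub>M borel)"
    "{p \<in> space (borel \<Otimes>\<^sub>M borel). 1 < fst p \<and> fst p \<le> snd p \<and> snd p \<le> (2::real)} \<in> sets (borel \<Otimes>\<^sub>M borel)"
    "{p \<in> space (borel \<Otimes>\<^sub>M borel). 1 < snd p \<and> snd p < fst p \<and> fst p \<le> (2::real)} \<in> sets (borel \<Otimes>\<^sub>M borel)"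
    by measurable
  then show "up0 \<in> sets borel" "dn0 \<in> sets borel" "up1 \<in> sets borel" "dn1 \<in> sets borel"
    by (simp_all only: borel_prod triangle_defs case_prod_beta' space_borel UNIV_I simp_thms)
qed

text \<open>Cavalieri's principle combined with the fundamental theorem of calculus. The section at
  \<open>a\<close> is exempt, being a null set of sections: at \<open>u = 1\<close> the section of
  \<open>up1\<close> is empty although the length formula \<open>2 - u\<close> gives 1.\<close>

lemma emeasure_by_sections:
  fixes S :: "(real \<times> real) set"
  assumes S: "S \<in> sets borel" and "a \<le> b"
    and F: "\<And>u. (F has_real_derivative f u) (at u)" "\<And>u. u \<in> {a..b} \<Longrightarrow> 0 \<le> f u"
    and f: "f \<in> borel_measurable borel"
    and sec: "\<And>u. u \<noteq> a \<Longrightarrow> emeasure lborel (Pair u -` S) = (if u \<in> {a..b} then ennreal (f u) else 0)"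
  shows "emeasure lborel S = ennreal (F b - F a)"
proof -
  have "emeasure lborel S = emeasure (lborel \<Otimes>\<^sub>M lborel) S"
    by (simp add: lborel_prod)
  also have "\<dots> = (\<integral>\<^sup>+u. emeasure lborel (Pair u -` S) \<partial>lborel)"
    by (rule lborel.emeasure_pair_measure_alt) (use S in \<open>simp only: sets_lborel lborel_prod\<close>)
  also have "\<dots> = (\<integral>\<^sup>+u. ennreal (f u) * indicator {a..b} u \<partial>lborel)"
  proof (rule nn_integral_cong_AE)
    show "AE u in lborel. emeasure lborel (Pair u -` S) = ennreal (f u) * indicator {a..b} u"
      using AE_lborel_singleton[of a] by eventually_elim (simp add: sec indicator_def)
  qed
  also have "\<dots> = ennreal (F b - F a)"
    using F by (intro nn_integral_FTC_Icc f \<open>a \<le> b\<close>) (auto intro: has_field_derivative_at_within)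
  finally show ?thesis .
qed

lemma emeasure_triangles:
  "emeasure lborel up0 = ennreal (1/2)" "emeasure lborel dn0 = ennreal (1/2)"
  "emeasure lborel up1 = ennreal (1/2)" "emeasure lborel dn1 = ennreal (1/2)"
proof -
  have s: "Pair u -` up0 = (if u \<in> {0..1} then {u..1} else {})"
    "Pair u -` dn0 = (if u \<in> {0..1} then {0..<u} else {})"
    "u \<noteq> 1 \<Longrightarrow> Pair u -` up1 = (if u \<in> {1..2} then {u..2} else {})"
    "Pair u -` dn1 = (if u \<in> {1..2} then {1<..<u} else {})" for u
    by (auto simp: triangle_defs)
  \<comment> \<open>Each right-hand side keeps the unevaluated form \<open>F b - F a\<close>; the
    antiderivatives of the four section lengths are \<open>u - u^2/2\<close>, \<open>u^2/2\<close>,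
    \<open>2*u - u^2/2\<close> and \<open>u^2/2 - u\<close>.\<close>
  have "emeasure lborel up0 = ennreal ((1 - 1\<^sup>2/2) - (0 - 0\<^sup>2/2))"
    by (rule emeasure_by_sections[where f = "\<lambda>u. 1 - u"])
       (auto intro!: derivative_eq_intros simp: s)
  moreover have "emeasure lborel dn0 = ennreal (1\<^sup>2/2 - 0\<^sup>2/2)"
    by (rule emeasure_by_sections[where f = "\<lambda>u. u"])
       (auto intro!: derivative_eq_intros simp: s)
  moreover have "emeasure lborel up1 = ennreal ((2 * 2 - 2\<^sup>2/2) - (2 * 1 - 1\<^sup>2/2))"
    by (rule emeasure_by_sections[where f = "\<lambda>u. 2 - u"])
       (auto intro!: derivative_eq_intros simp: s)
  moreover have "emeasure lborel dn1 = ennreal ((2\<^sup>2/2 - 2) - (1\<^sup>2/2 - 1))"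
    by (rule emeasure_by_sections[where f = "\<lambda>u. u - 1"])
       (auto intro!: derivative_eq_intros simp: s)
  ultimately show "emeasure lborel up0 = ennreal (1/2)" "emeasure lborel dn0 = ennreal (1/2)"
    "emeasure lborel up1 = ennreal (1/2)" "emeasure lborel dn1 = ennreal (1/2)"
    by (simp_all add: power2_eq_square)
qed

abbreviation "area \<equiv> measure (lborel :: (real \<times> real) measure)"

lemma fmeasurable_triangles:
  "up0 \<in> fmeasurable lborel" "dn0 \<in> fmeasurable lborel"
  "up1 \<in> fmeasurable lborel" "dn1 \<in> fmeasurable lborel"
  by (rule fmeasurableI; simp only: emeasure_triangles ennreal_less_top sets_lborel triangle_sets infinity_ennreal_def)+

lemma area_triangles [simp]:
  "area up0 = 1/2" "area dn0 = 1/2" "area up1 = 1/2" "area dn1 = 1/2"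
  by (rule measure_eq_emeasure_eq_ennreal[OF _ emeasure_triangles(1)]
        measure_eq_emeasure_eq_ennreal[OF _ emeasure_triangles(2)]
        measure_eq_emeasure_eq_ennreal[OF _ emeasure_triangles(3)]
        measure_eq_emeasure_eq_ennreal[OF _ emeasure_triangles(4)]; simp)+

text \<open>\<open>P\<close> may have infinite area, but its part inside a triangle is finite. This
  allows the passage from \<open>ennreal\<close> to real areas.\<close>

lemma emeasure_triangle_Int:
  assumes "T \<in> {up0, dn0, up1, dn1}" "P \<in> sets borel"
  shows "emeasure lborel (T \<inter> P) = ennreal (area (T \<inter> P))"
proof -
  have "T \<inter> P \<in> fmeasurable lborel"
    using assms fmeasurable_triangles by (auto intro: fmeasurable_Int_fmeasurable)
  then show ?thesis
    by (intro emeasure_eq_ennreal_measure) (auto simp: fmeasurable_def)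
qed

lemma area_triangle_Int_le:
  assumes "T \<in> {up0, dn0, up1, dn1}" "P \<in> sets borel"
  shows "area (T \<inter> P) \<le> 1/2"
proof -
  have "area (T \<inter> P) \<le> area T"
    using assms fmeasurable_triangles by (auto intro!: measure_mono_fmeasurable)
  then show ?thesis using assms by auto
qed

section \<open>Probabilities of product events under the two densities\<close>

lemma dens_eq: "ennreal (dens z) = block_density [(up0, up1), (dn0, dn1), (up1, up0), (dn1, dn0)] z"
  unfolding dens_def block_density_def
  by (cases z) (simp add: triangle_defs indicator_def of_bool_def)

lemma dens_star_eq:
  "ennreal (dens_star z) = block_density [(up0, dn0), (dn0, dn1), (up1, up0), (dn1, up1)] z"
  unfolding dens_star_def block_density_def
  by (cases z) (simp add: triangle_defs indicator_def of_bool_def)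

lemma
  assumes "P \<in> sets borel" "Q \<in> sets borel"
  shows emeasure_dens: "emeasure (density lborel dens) (rect4 P Q) = ennreal
      (area (up0 \<inter> P) * area (up1 \<inter> Q) + area (dn0 \<inter> P) * area (dn1 \<inter> Q)
     + area (up1 \<inter> P) * area (up0 \<inter> Q) + area (dn1 \<inter> P) * area (dn0 \<inter> Q))"
  and emeasure_dens_star: "emeasure (density lborel dens_star) (rect4 P Q) = ennreal
      (area (up0 \<inter> P) * area (dn0 \<inter> Q) + area (dn0 \<inter> P) * area (dn1 \<inter> Q)
     + area (up1 \<inter> P) * area (up0 \<inter> Q) + area (dn1 \<inter> P) * area (up1 \<inter> Q))"
proof -
  show "emeasure (density lborel dens) (rect4 P Q) = ennreal
      (area (up0 \<inter> P) * area (up1 \<inter> Q) + area (dn0 \<inter> P) * area (dn1 \<inter> Q)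
     + area (up1 \<inter> P) * area (up0 \<inter> Q) + area (dn1 \<inter> P) * area (dn0 \<inter> Q))"
    unfolding dens_eq
    by (subst emeasure_block_density)
       (use assms in \<open>auto simp: emeasure_triangle_Int ennreal_mult' add.assoc\<close>)
  show "emeasure (density lborel dens_star) (rect4 P Q) = ennreal
      (area (up0 \<inter> P) * area (dn0 \<inter> Q) + area (dn0 \<inter> P) * area (dn1 \<inter> Q)
     + area (up1 \<inter> P) * area (up0 \<inter> Q) + area (dn1 \<inter> P) * area (up1 \<inter> Q))"
    unfolding dens_star_eq
    by (subst emeasure_block_density)
       (use assms in \<open>auto simp: emeasure_triangle_Int ennreal_mult' add.assoc\<close>)
qed

text \<open>Total mass: four blocks of mass \<open>1/2 * 1/2\<close> each.\<close>

lemma prob_space_dens: "prob_space (density lborel dens)"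
proof
  have "rect4 UNIV UNIV = UNIV" by (auto simp: rect4_def)
  then show "emeasure (density lborel dens) (space (density lborel dens)) = 1"
    using emeasure_dens[of UNIV UNIV] by simp
qed

lemma prob_space_dens_star: "prob_space (density lborel dens_star)"
proof
  have "rect4 UNIV UNIV = UNIV" by (auto simp: rect4_def)
  then show "emeasure (density lborel dens_star) (space (density lborel dens_star)) = 1"
    using emeasure_dens_star[of UNIV UNIV] by simp
qed

text \<open>The event is the preimage of \<open>rect4 P Q\<close> under the quadruple, whose law is
  \<open>density lborel f\<close>.\<close>

lemma prob_rect4:
  assumes "distributed M lborel (\<lambda>\<omega>. (X \<omega> (1::nat), X \<omega> 2, Y \<omega> (1::nat), Y \<omega> 2)) f"
    and [measurable]: "P \<in> sets borel" "Q \<in> sets borel"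
  shows "\<P>(\<omega> in M. (X \<omega> 1, X \<omega> 2) \<in> P \<and> (Y \<omega> 1, Y \<omega> 2) \<in> Q)
      = measure (density lborel f) (rect4 P Q)"
proof -
  let ?Z = "\<lambda>\<omega>. (X \<omega> (1::nat), X \<omega> 2, Y \<omega> (1::nat), Y \<omega> 2)"
  have Z: "?Z \<in> M \<rightarrow>\<^sub>M lborel" and d: "distr M lborel ?Z = density lborel f"
    using assms(1) by (auto simp: distributed_def)
  have "measure (density lborel f) (rect4 P Q) = measure M (?Z -` rect4 P Q \<inter> space M)"
    unfolding d[symmetric] by (intro measure_distr Z) simp
  also have "?Z -` rect4 P Q \<inter> space M = {\<omega> \<in> space M. (X \<omega> 1, X \<omega> 2) \<in> P \<and> (Y \<omega> 1, Y \<omega> 2) \<in> Q}"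
    by (auto simp: rect4_def)
  finally show ?thesis by simp
qed

lemma prob_dens:
  assumes "distributed M lborel (\<lambda>\<omega>. (X \<omega> (1::nat), X \<omega> 2, Y \<omega> (1::nat), Y \<omega> 2)) dens"
    and "P \<in> sets borel" "Q \<in> sets borel"
  shows "\<P>(\<omega> in M. (X \<omega> 1, X \<omega> 2) \<in> P \<and> (Y \<omega> 1, Y \<omega> 2) \<in> Q)
    = area (up0 \<inter> P) * area (up1 \<inter> Q) + area (dn0 \<inter> P) * area (dn1 \<inter> Q)
     + area (up1 \<inter> P) * area (up0 \<inter> Q) + area (dn1 \<inter> P) * area (dn0 \<inter> Q)"
  by (subst prob_rect4[OF assms]) (simp add: measure_def emeasure_dens assms del: ennreal_plus)

lemma prob_dens_star:
  assumes "distributed M lborel (\<lambda>\<omega>. (X \<omega> (1::nat), X \<omega> 2, Y \<omega> (1::nat), Y \<omega> 2)) dens_star"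
    and "P \<in> sets borel" "Q \<in> sets borel"
  shows "\<P>(\<omega> in M. (X \<omega> 1, X \<omega> 2) \<in> P \<and> (Y \<omega> 1, Y \<omega> 2) \<in> Q)
    = area (up0 \<inter> P) * area (dn0 \<inter> Q) + area (dn0 \<inter> P) * area (dn1 \<inter> Q)
     + area (up1 \<inter> P) * area (up0 \<inter> Q) + area (dn1 \<inter> P) * area (up1 \<inter> Q)"
  by (subst prob_rect4[OF assms]) (simp add: measure_def emeasure_dens_star assms del: ennreal_plus)

section \<open>The common law of the pairs and its symmetry\<close>

text \<open>On Borel sets this is the uniform distribution on the union of [0,1]^2 and (1,2]^2, a
  region of area 2.\<close>

definition "square_law P = (area (up0 \<inter> P) + area (dn0 \<inter> P) + area (up1 \<inter> P) + area (dn1 \<inter> P)) / 2"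

text \<open>A single triangle is not symmetric in its coordinates, but the two triangles of a square
  together are. Once they are merged, both sides become sums of products of the same interval
  lengths.\<close>

lemma square_law_swap:
  assumes [measurable]: "S \<in> sets borel"
  shows "square_law (S \<times> UNIV) = square_law (UNIV \<times> S)"
proof -
  have un: "area (T \<inter> P) + area (T' \<inter> P) = area ((T \<union> T') \<inter> P)"
    if "T \<in> {up0, dn0, up1, dn1}" "T' \<in> {up0, dn0, up1, dn1}" "T \<inter> T' = {}" "P \<in> sets borel" for T T' P
  proof -
    have "T \<inter> P \<in> fmeasurable lborel" "T' \<inter> P \<in> fmeasurable lborel"
      using that fmeasurable_triangles by (auto intro: fmeasurable_Int_fmeasurable)
    then have "measure lborel (T \<inter> P \<union> T' \<inter> P) = area (T \<inter> P) + area (T' \<inter> P)"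
      using that(3) by (intro measure_Un2[THEN trans]) (auto intro!: arg_cong[where f = area])
    then show ?thesis by (simp add: Int_Un_distrib2)
  qed
  have m: "S \<times> UNIV \<in> sets (borel :: (real \<times> real) measure)" "UNIV \<times> S \<in> sets (borel :: (real \<times> real) measure)"
    by (simp_all flip: borel_prod)
  have rect: "area (A \<times> B) = measure lborel A * measure lborel B"
    if [measurable]: "A \<in> sets borel" "B \<in> sets borel" for A B :: "real set"
    unfolding measure_def
    by (simp add: lborel.emeasure_pair_measure_Times enn2real_mult flip: lborel_prod)
  have sq: "up0 \<union> dn0 = {0..1} \<times> {0..1}" "up1 \<union> dn1 = {1<..2} \<times> {1<..2}"
    "up0 \<inter> dn0 = {}" "up1 \<inter> dn1 = {}"
    by (auto simp: triangle_defs)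
  have "2 * square_law (S \<times> UNIV) = area (({0..1} \<inter> S) \<times> {0..1}) + area (({1<..2} \<inter> S) \<times> {1<..2})"
    using m un[of up0 dn0 "S \<times> UNIV"] un[of up1 dn1 "S \<times> UNIV"]
    by (simp add: square_law_def sq Times_Int_Times)
  moreover have "2 * square_law (UNIV \<times> S) = area ({0..1} \<times> ({0..1} \<inter> S)) + area ({1<..2} \<times> ({1<..2} \<inter> S))"
    using m un[of up0 dn0 "UNIV \<times> S"] un[of up1 dn1 "UNIV \<times> S"]
    by (simp add: square_law_def sq Times_Int_Times)
  ultimately show ?thesis by (simp add: rect)
qed

text \<open>With one vector unconstrained its factor is \<open>1/2\<close> in every block, and each
  of the four triangles occurs exactly once on either side of the list. The same holds for
  \<open>dens_star\<close>.\<close>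

lemma
  assumes "distributed M lborel (\<lambda>\<omega>. (X \<omega> (1::nat), X \<omega> 2, Y \<omega> (1::nat), Y \<omega> 2)) dens"
    and "P \<in> sets borel"
  shows prob_dens_X: "\<P>(\<omega> in M. (X \<omega> 1, X \<omega> 2) \<in> P) = square_law P"
    and prob_dens_Y: "\<P>(\<omega> in M. (Y \<omega> 1, Y \<omega> 2) \<in> P) = square_law P"
  using prob_dens[OF assms(1), of P UNIV] prob_dens[OF assms(1), of UNIV P] assms(2)
  by (simp_all add: square_law_def)

lemma
  assumes "distributed M lborel (\<lambda>\<omega>. (X \<omega> (1::nat), X \<omega> 2, Y \<omega> (1::nat), Y \<omega> 2)) dens_star"
    and "P \<in> sets borel"
  shows prob_dens_star_X: "\<P>(\<omega> in M. (X \<omega> 1, X \<omega> 2) \<in> P) = square_law P"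
    and prob_dens_star_Y: "\<P>(\<omega> in M. (Y \<omega> 1, Y \<omega> 2) \<in> P) = square_law P"
  using prob_dens_star[OF assms(1), of P UNIV] prob_dens_star[OF assms(1), of UNIV P] assms(2)
  by (simp_all add: square_law_def)

section \<open>From laws of pairs to laws of random vectors\<close>

text \<open>The function is restricted to the index set because points of a product space
  \<open>PiM\<close> are extensional.\<close>

definition "vec2 a b = (\<lambda>i\<in>{1..2::nat}. if i = 1 then a else b :: real)"

lemma vec2_simps [simp]: "vec2 a b 1 = a" "vec2 a b (Suc 0) = a" "vec2 a b 2 = b"
  by (simp_all add: vec2_def)

lemma random_vector_vec2:
  assumes "f \<in> M \<rightarrow>\<^sub>M borel" "g \<in> M \<rightarrow>\<^sub>M borel"
  shows "random_vector 2 M (\<lambda>\<omega>. vec2 (f \<omega>) (g \<omega>))"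
  unfolding vec2_def by (rule measurable_restrict) (use assms in auto)

lemma vec2_eq:
  assumes "x \<in> space (euclidean_borel 2)"
  shows "vec2 (x 1) (x 2) = x"
  using assms
  by (intro ext) (auto simp: vec2_def space_PiM PiE_def extensional_def numeral_2_eq_2 le_Suc_eq)

text \<open>A point of the product space is determined by its two coordinates, so an event
  \<open>E\<close> there pulls back along \<open>vec2\<close> to a Borel set of the plane, on which
  both laws are given by \<open>q\<close>.\<close>

lemma distr_eq_if_pair_law:
  assumes "prob_space M" "prob_space N" and X: "random_vector 2 M X" and X': "random_vector 2 N X'"
    and M: "\<And>P. P \<in> sets borel \<Longrightarrow> \<P>(\<omega> in M. (X \<omega> 1, X \<omega> 2) \<in> P) = q P"
    and N: "\<And>P. P \<in> sets borel \<Longrightarrow> \<P>(\<omega> in N. (X' \<omega> 1, X' \<omega> 2) \<in> P) = q P"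
  shows "distr M (euclidean_borel 2) X = distr N (euclidean_borel 2) X'"
proof (rule measure_eqI)
  interpret M: prob_space M by fact
  interpret N: prob_space N by fact
  fix E assume "E \<in> sets (distr M (euclidean_borel 2) X)"
  then have E: "E \<in> sets (euclidean_borel 2)" by simp
  define P where "P = (\<lambda>p. vec2 (fst p) (snd p)) -` E"
  have "random_vector 2 borel (\<lambda>p. vec2 (fst p) (snd p))"
    by (intro random_vector_vec2 borel_measurable_continuous_onI continuous_intros)
  from measurable_sets[OF this E] have P: "P \<in> sets borel"
    by (simp add: P_def)
  have "X -` E \<inter> space M = {\<omega> \<in> space M. (X \<omega> 1, X \<omega> 2) \<in> P}"
    using vec2_eq[OF measurable_space[OF X]] by (auto simp: P_def simp del: One_nat_def)
  moreover have "X' -` E \<inter> space N = {\<omega> \<in> space N. (X' \<omega> 1, X' \<omega> 2) \<in> P}"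
    using vec2_eq[OF measurable_space[OF X']] by (auto simp: P_def simp del: One_nat_def)
  ultimately show "emeasure (distr M (euclidean_borel 2) X) E = emeasure (distr N (euclidean_borel 2) X') E"
    using E M[OF P] N[OF P] by (simp add: emeasure_distr[OF X] emeasure_distr[OF X'] M.emeasure_eq_measure N.emeasure_eq_measure
        del: One_nat_def)
qed simp

lemma distr_components_eq:
  assumes "prob_space M" and X: "random_vector 2 M X"
    and M: "\<And>P. P \<in> sets borel \<Longrightarrow> \<P>(\<omega> in M. (X \<omega> 1, X \<omega> 2) \<in> P) = square_law P"
  shows "distr M borel (\<lambda>\<omega>. X \<omega> 1) = distr M borel (\<lambda>\<omega>. X \<omega> 2)"
proof (rule measure_eqI)
  interpret prob_space M by fact
  fix S assume "S \<in> sets (distr M borel (\<lambda>\<omega>. X \<omega> 1))"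
  then have S: "S \<in> sets borel" by simp
  have m: "(\<lambda>\<omega>. X \<omega> i) \<in> M \<rightarrow>\<^sub>M borel" if "i \<in> {1..2}" for i
    by (rule measurable_compose[OF X measurable_component_singleton]) (fact that)
  have b: "S \<times> UNIV \<in> sets (borel :: (real \<times> real) measure)" "UNIV \<times> S \<in> sets (borel :: (real \<times> real) measure)"
    using S by (simp_all flip: borel_prod)
  have "(\<lambda>\<omega>. X \<omega> 1) -` S \<inter> space M = {\<omega> \<in> space M. (X \<omega> 1, X \<omega> 2) \<in> S \<times> UNIV}"
    "(\<lambda>\<omega>. X \<omega> 2) -` S \<inter> space M = {\<omega> \<in> space M. (X \<omega> 1, X \<omega> 2) \<in> UNIV \<times> S}"
    by auto
  then show "emeasure (distr M borel (\<lambda>\<omega>. X \<omega> 1)) S = emeasure (distr M borel (\<lambda>\<omega>. X \<omega> 2)) S"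
    using M[OF b(1)] M[OF b(2)] S by (simp add: emeasure_distr m emeasure_eq_measure square_law_swap)
qed simp

section \<open>Ordinal patterns of length two\<close>

lemma interval_1_2: "{1..2} = {1, 2 :: nat}"
  by auto

text \<open>Only two permutations of \<open>{1, 2}\<close> exist, and a tie counts as increasing
  since \<open>1 < 2\<close>.\<close>

lemma ordinal_pattern_2:
  "ordinal_pattern 2 x = (if x 1 \<le> x 2 then id else Transposition.transpose 1 2)"
proof -
  show ?thesis
    unfolding ordinal_pattern_def interval_1_2 permutes_doubleton_iff
    by (rule the_equality) (auto simp: transpose_apply_first)
qed

lemma swap_neq_id: "Transposition.transpose 1 2 \<noteq> (id :: nat \<Rightarrow> nat)"
  by (metis id_apply one_eq_numeral_iff semiring_norm(83) transpose_apply_first)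

text \<open>The half plane on which the pattern is \<open>id\<close>; on its complement it is the
  transposition.\<close>

definition "U = {(u, v). u \<le> (v :: real)}"

lemma U_sets [measurable]: "U \<in> sets borel"
proof -
  have "{p \<in> space (borel \<Otimes>\<^sub>M borel). fst p \<le> (snd p :: real)} \<in> sets (borel \<Otimes>\<^sub>M borel)"
    by measurable
  then show ?thesis by (simp only: borel_prod U_def case_prod_beta' space_borel UNIV_I simp_thms)
qed

lemma triangle_Int_U [simp]:
  "up0 \<inter> U = up0" "up1 \<inter> U = up1" "dn0 \<inter> U = {}" "dn1 \<inter> U = {}"
  "up0 \<inter> - U = {}" "up1 \<inter> - U = {}" "dn0 \<inter> - U = dn0" "dn1 \<inter> - U = dn1"
  by (auto simp: triangle_defs U_def)

text \<open>Agreement of the patterns is the disjoint union of two product events: both are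
  \<open>id\<close> or both are the transposition.\<close>

lemma prob_same_pattern:
  assumes "prob_space M" "random_vector 2 M X" "random_vector 2 M Y"
  shows "\<P>(\<omega> in M. ordinal_pattern 2 (X \<omega>) = ordinal_pattern 2 (Y \<omega>))
   = \<P>(\<omega> in M. (X \<omega> 1, X \<omega> 2) \<in> U \<and> (Y \<omega> 1, Y \<omega> 2) \<in> U)
   + \<P>(\<omega> in M. (X \<omega> 1, X \<omega> 2) \<in> - U \<and> (Y \<omega> 1, Y \<omega> 2) \<in> - U)"
proof -
  interpret prob_space M by fact
  have [measurable]: "(\<lambda>\<omega>. X \<omega> i) \<in> M \<rightarrow>\<^sub>M borel" "(\<lambda>\<omega>. Y \<omega> i) \<in> M \<rightarrow>\<^sub>M borel" if "i \<in> {1..2}" for i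
    by (rule measurable_compose[OF _ measurable_component_singleton[OF that]], fact)+
  have "{\<omega> \<in> space M. ordinal_pattern 2 (X \<omega>) = ordinal_pattern 2 (Y \<omega>)}
      = {\<omega> \<in> space M. X \<omega> 1 \<le> X \<omega> 2 \<and> Y \<omega> 1 \<le> Y \<omega> 2} \<union> {\<omega> \<in> space M. \<not> X \<omega> 1 \<le> X \<omega> 2 \<and> \<not> Y \<omega> 1 \<le> Y \<omega> 2}"
    using swap_neq_id by (auto simp: ordinal_pattern_2 split: if_splits)
  then show ?thesis
    by (simp add: U_def) (subst finite_measure_Union; auto)
qed

text \<open>Each pattern has probability \<open>1/2\<close> under \<open>square_law\<close>, so the
  sum over the two patterns is \<open>1/4 + 1/4\<close>.\<close>

lemma pattern_product_sum_half:
  assumes X: "\<And>P. P \<in> sets borel \<Longrightarrow> \<P>(\<omega> in M. (X \<omega> 1, X \<omega> 2) \<in> P) = square_law P"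
    and Y: "\<And>P. P \<in> sets borel \<Longrightarrow> \<P>(\<omega> in M. (Y \<omega> 1, Y \<omega> 2) \<in> P) = square_law P"
  shows "pattern_product_sum 2 M X Y = 1/2"
proof -
  have S: "{\<pi>. \<pi> permutes {1..2}} = {id, Transposition.transpose 1 2 :: nat \<Rightarrow> nat}"
    unfolding interval_1_2 by (auto simp: permutes_doubleton_iff)
  have ev: "ordinal_pattern 2 x = id \<longleftrightarrow> (x 1, x 2) \<in> U"
    "ordinal_pattern 2 x = Transposition.transpose 1 2 \<longleftrightarrow> (x 1, x 2) \<in> - U" for x
    using swap_neq_id by (auto simp: ordinal_pattern_2 U_def)
  have [measurable]: "- U \<in> sets borel" by (intro borel_comp U_sets)
  show ?thesis
    using swap_neq_id
    \<comment> \<open>\<open>Compl_iff\<close> stays off so that membership in \<open>- U\<close>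
      keeps the form to which \<open>X\<close> and \<open>Y\<close> apply.\<close>
    by (simp add: pattern_product_sum_def S ev X Y del: Compl_iff One_nat_def) (simp add: square_law_def)
qed

section \<open>Orthants and concordance\<close>

text \<open>If the orthant meets \<open>T'\<close>, then \<open>a\<close> and \<open>b\<close>
  exceed 1, so it contains all of \<open>T\<close>, whose area \<open>1/2\<close> is the largest
  possible value on the left. Otherwise the left side is 0.\<close>

lemma area_lower_orthant:
  assumes "T \<in> {up0, dn0}" "T' \<in> {up1, dn1}"
  shows "area (T' \<inter> {..a} \<times> {..b}) \<le> area (T \<inter> {..a} \<times> {..b})"
proof (cases "T' \<inter> {..a} \<times> {..b} = {}")
  case False
  then have "T \<inter> {..a} \<times> {..b} = T"
    using assms by (auto simp: triangle_defs)
  moreover have "{..a} \<times> {..b} \<in> sets (borel :: (real \<times> real) measure)"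
    by (simp flip: borel_prod)
  ultimately show ?thesis
    using assms area_triangle_Int_le[of T' "{..a} \<times> {..b}"] by auto
qed simp

text \<open>The mirror image: an upper orthant that meets \<open>T\<close> has \<open>a\<close> and
  \<open>b\<close> at most 1 and hence contains \<open>T'\<close>.\<close>

lemma area_upper_orthant:
  assumes "T \<in> {up0, dn0}" "T' \<in> {up1, dn1}"
  shows "area (T \<inter> {a..} \<times> {b..}) \<le> area (T' \<inter> {a..} \<times> {b..})"
proof (cases "T \<inter> {a..} \<times> {b..} = {}")
  case False
  then have "T' \<inter> {a..} \<times> {b..} = T'"
    using assms by (auto simp: triangle_defs)
  moreover have "{a..} \<times> {b..} \<in> sets (borel :: (real \<times> real) measure)"
    by (simp flip: borel_prod)
  ultimately show ?thesis
    using assms area_triangle_Int_le[of T "{a..} \<times> {b..}"] by auto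
qed simp

lemma concordance_le_dens:
  assumes D: "distributed M lborel (\<lambda>\<omega>. (X \<omega> 1, X \<omega> 2, Y \<omega> 1, Y \<omega> 2)) dens"
    and D': "distributed N lborel (\<lambda>\<omega>. (X' \<omega> 1, X' \<omega> 2, Y' \<omega> 1, Y' \<omega> 2)) dens_star"
  shows "concordance_le 2 M X Y N X' Y'"
  unfolding concordance_le_def
proof (intro allI conjI)
  fix x y :: "nat \<Rightarrow> real"
  have m: "{..a} \<times> {..b} \<in> sets (borel :: (real \<times> real) measure)"
    "{a..} \<times> {b..} \<in> sets (borel :: (real \<times> real) measure)" for a b :: real
    by (simp_all flip: borel_prod)
  let ?P = "{..x 1} \<times> {..x 2}" and ?Q = "{..y 1} \<times> {..y 2}"
  \<comment> \<open>The blocks \<open>(dn0, dn1)\<close> and \<open>(up1, up0)\<close> are common to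
    both densities and cancel in the difference of the distribution functions; what remains factors
    into this product.\<close>
  have "0 \<le> (area (up0 \<inter> ?P) - area (dn1 \<inter> ?P)) * (area (dn0 \<inter> ?Q) - area (up1 \<inter> ?Q))"
    by (intro mult_nonneg_nonneg) (simp_all add: area_lower_orthant)
  then show "joint_cdf 2 M X Y x y \<le> joint_cdf 2 N X' Y' x y"
    using prob_dens[OF D m(1)[of "x 1" "x 2"] m(1)[of "y 1" "y 2"]]
      prob_dens_star[OF D' m(1)[of "x 1" "x 2"] m(1)[of "y 1" "y 2"]]
    by (simp add: joint_cdf_def interval_1_2 algebra_simps del: One_nat_def)
  let ?P = "{x 1..} \<times> {x 2..}" and ?Q = "{y 1..} \<times> {y 2..}"
  \<comment> \<open>The same factorization for the survival functions, now with two nonpositive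
    factors.\<close>
  have "0 \<le> (area (up0 \<inter> ?P) - area (dn1 \<inter> ?P)) * (area (dn0 \<inter> ?Q) - area (up1 \<inter> ?Q))"
    by (intro mult_nonpos_nonpos) (simp_all add: area_upper_orthant)
  then show "joint_survival 2 M X Y x y \<le> joint_survival 2 N X' Y' x y"
    using prob_dens[OF D m(2)[of "x 1" "x 2"] m(2)[of "y 1" "y 2"]]
      prob_dens_star[OF D' m(2)[of "x 1" "x 2"] m(2)[of "y 1" "y 2"]]
    by (simp add: joint_survival_def interval_1_2 algebra_simps del: One_nat_def)
qed

section \<open>The counterexample and its realization\<close>

text \<open>This covers every realization of the two densities, possibly on different probability
  spaces; that a realization exists is shown separately.\<close>

lemma opd_counterexample:
  assumes M: "prob_space M" "random_vector 2 M X" "random_vector 2 M Y"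
    and N: "prob_space N" "random_vector 2 N X'" "random_vector 2 N Y'"
    and D: "distributed M lborel (\<lambda>\<omega>. (X \<omega> 1, X \<omega> 2, Y \<omega> 1, Y \<omega> 2)) dens"
    and D': "distributed N lborel (\<lambda>\<omega>. (X' \<omega> 1, X' \<omega> 2, Y' \<omega> 1, Y' \<omega> 2)) dens_star"
  shows "distr M (euclidean_borel 2) X = distr N (euclidean_borel 2) X' \<and>
        distr M (euclidean_borel 2) Y = distr N (euclidean_borel 2) Y' \<and>
        distr M borel (\<lambda>\<omega>. X \<omega> 1) = distr M borel (\<lambda>\<omega>. X \<omega> 2) \<and>
        distr M borel (\<lambda>\<omega>. Y \<omega> 1) = distr M borel (\<lambda>\<omega>. Y \<omega> 2) \<and>
        concordance_le 2 M X Y N X' Y' \<and>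
        \<P>(\<omega> in M. ordinal_pattern 2 (X \<omega>) = ordinal_pattern 2 (Y \<omega>)) = 1 \<and>
        \<P>(\<omega> in N. ordinal_pattern 2 (X' \<omega>) = ordinal_pattern 2 (Y' \<omega>)) = 1 / 2 \<and>
        opd 2 M X Y > opd 2 N X' Y'"
proof (intro conjI)
  note laws = prob_dens_X[OF D] prob_dens_Y[OF D] prob_dens_star_X[OF D'] prob_dens_star_Y[OF D']
  show "distr M (euclidean_borel 2) X = distr N (euclidean_borel 2) X'"
    by (rule distr_eq_if_pair_law[OF M(1) N(1) M(2) N(2) laws(1,3)])
  show "distr M (euclidean_borel 2) Y = distr N (euclidean_borel 2) Y'"
    by (rule distr_eq_if_pair_law[OF M(1) N(1) M(3) N(3) laws(2,4)])
  show "distr M borel (\<lambda>\<omega>. X \<omega> 1) = distr M borel (\<lambda>\<omega>. X \<omega> 2)"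
    by (rule distr_components_eq[OF M(1,2) laws(1)])
  show "distr M borel (\<lambda>\<omega>. Y \<omega> 1) = distr M borel (\<lambda>\<omega>. Y \<omega> 2)"
    by (rule distr_components_eq[OF M(1,3) laws(2)])
  show "concordance_le 2 M X Y N X' Y'"
    by (rule concordance_le_dens[OF D D'])
  have nU: "- U \<in> sets borel" by (intro borel_comp U_sets)
  show same: "\<P>(\<omega> in M. ordinal_pattern 2 (X \<omega>) = ordinal_pattern 2 (Y \<omega>)) = 1"
    unfolding prob_same_pattern[OF M] prob_dens[OF D U_sets U_sets] prob_dens[OF D nU nU] by simp
  show same': "\<P>(\<omega> in N. ordinal_pattern 2 (X' \<omega>) = ordinal_pattern 2 (Y' \<omega>)) = 1 / 2"
    unfolding prob_same_pattern[OF N] prob_dens_star[OF D' U_sets U_sets] prob_dens_star[OF D' nU nU]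
    by simp
  have "pattern_product_sum 2 M X Y = 1/2" "pattern_product_sum 2 N X' Y' = 1/2"
    by (rule pattern_product_sum_half[OF laws(1,2)] pattern_product_sum_half[OF laws(3,4)]; assumption)+
  \<comment> \<open>The values are \<open>(1 - 1/2) / (1 - 1/2) = 1\<close> and
    \<open>(1/2 - 1/2) / (1 - 1/2) = 0\<close>.\<close>
  then show "opd 2 M X Y > opd 2 N X' Y'"
    by (simp add: opd_def same same')
qed

text \<open>The product of the two density measures carries both quadruples as its independent
  components. A common space is wanted because the final refutation quantifies over a single measure
  \<open>M\<close>.\<close>

lemma ex_independent_pair:
  fixes f g :: "real \<times> real \<times> real \<times> real \<Rightarrow> ennreal"
  assumes f: "prob_space (density lborel f)" "f \<in> borel_measurable borel"
    and g: "prob_space (density lborel g)" "g \<in> borel_measurable borel"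
  obtains M :: "((real \<times> real \<times> real \<times> real) \<times> (real \<times> real \<times> real \<times> real)) measure" and X Y X' Y'
  where "prob_space M" "random_vector 2 M X" "random_vector 2 M Y"
    "random_vector 2 M X'" "random_vector 2 M Y'"
    "distributed M lborel (\<lambda>\<omega>. (X \<omega> 1, X \<omega> 2, Y \<omega> 1, Y \<omega> 2)) f"
    "distributed M lborel (\<lambda>\<omega>. (X' \<omega> 1, X' \<omega> 2, Y' \<omega> 1, Y' \<omega> 2)) g"
proof
  interpret f: prob_space "density lborel f" by fact
  interpret g: prob_space "density lborel g" by fact
  interpret pair_prob_space "density lborel f" "density lborel g" ..
  let ?M = "density lborel f \<Otimes>\<^sub>M density lborel g"
  have c: "(\<lambda>z :: real \<times> real \<times> real \<times> real. fst z) \<in> borel \<rightarrow>\<^sub>M borel"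
    "(\<lambda>z :: real \<times> real \<times> real \<times> real. fst (snd z)) \<in> borel \<rightarrow>\<^sub>M borel"
    "(\<lambda>z :: real \<times> real \<times> real \<times> real. fst (snd (snd z))) \<in> borel \<rightarrow>\<^sub>M borel"
    "(\<lambda>z :: real \<times> real \<times> real \<times> real. snd (snd (snd z))) \<in> borel \<rightarrow>\<^sub>M borel"
    by (auto intro!: borel_measurable_continuous_onI continuous_intros)
  have F: "fst \<in> ?M \<rightarrow>\<^sub>M borel" and S: "snd \<in> ?M \<rightarrow>\<^sub>M borel"
    using measurable_fst[of "density lborel f" "density lborel g"]
      measurable_snd[of "density lborel f" "density lborel g"]
    by (simp_all cong: measurable_cong_sets)
  show "prob_space ?M" by (rule prob_space_axioms)
  show "random_vector 2 ?M (\<lambda>\<omega>. vec2 (fst (fst \<omega>)) (fst (snd (fst \<omega>))))"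
    "random_vector 2 ?M (\<lambda>\<omega>. vec2 (fst (snd (snd (fst \<omega>)))) (snd (snd (snd (fst \<omega>)))))"
    "random_vector 2 ?M (\<lambda>\<omega>. vec2 (fst (snd \<omega>)) (fst (snd (snd \<omega>))))"
    "random_vector 2 ?M (\<lambda>\<omega>. vec2 (fst (snd (snd (snd \<omega>)))) (snd (snd (snd (snd \<omega>)))))"
    by (intro random_vector_vec2 measurable_compose[OF F] measurable_compose[OF S] c)+
  \<comment> \<open>\<open>lborel\<close> and \<open>density lborel f\<close> have the same
    measurable sets, so either may serve as the target of \<open>distr\<close>.\<close>
  have "distr ?M lborel fst = distr ?M (density lborel f) fst"
    by (intro distr_cong) auto
  also have "\<dots> = density lborel f" by (rule g.distr_pair_fst)
  finally show "distributed ?M lborel (\<lambda>\<omega>. (vec2 (fst (fst \<omega>)) (fst (snd (fst \<omega>))) 1,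
      vec2 (fst (fst \<omega>)) (fst (snd (fst \<omega>))) 2,
      vec2 (fst (snd (snd (fst \<omega>)))) (snd (snd (snd (fst \<omega>)))) 1,
      vec2 (fst (snd (snd (fst \<omega>)))) (snd (snd (snd (fst \<omega>)))) 2)) f"
    using F f by (simp add: distributed_def)
  have "distr ?M lborel snd = density lborel g"
  proof (rule measure_eqI)
    fix E assume "E \<in> sets (distr ?M lborel snd)"
    then have E: "E \<in> sets (density lborel g)" by simp
    \<comment> \<open>The preimage is a cylinder, and its first factor has mass 1.\<close>
    have "snd -` E \<inter> space ?M = space (density lborel f) \<times> E"
      by (auto simp: space_pair_measure)
    then show "emeasure (distr ?M lborel snd) E = emeasure (density lborel g) E"
      using S E f.emeasure_space_1
        g.emeasure_pair_measure_Times[OF sets.top[of "density lborel f"], of E]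
      by (simp add: emeasure_distr del: space_density)
  qed simp
  then show "distributed ?M lborel (\<lambda>\<omega>. (vec2 (fst (snd \<omega>)) (fst (snd (snd \<omega>))) 1,
      vec2 (fst (snd \<omega>)) (fst (snd (snd \<omega>))) 2,
      vec2 (fst (snd (snd (snd \<omega>)))) (snd (snd (snd (snd \<omega>)))) 1,
      vec2 (fst (snd (snd (snd \<omega>)))) (snd (snd (snd (snd \<omega>)))) 2)) g"
    using S g by (simp add: distributed_def)
qed

theorem mainTheorem2:
  shows
    "prob_space (density lborel dens) \<and> prob_space (density lborel dens_star) \<and>
     (\<forall>(M :: 'a measure) (N :: 'b measure) X Y X' Y'.
        prob_space M \<and> prob_space N \<and>
        random_vector 2 M X \<and> random_vector 2 M Y \<and>
        random_vector 2 N X' \<and> random_vector 2 N Y' \<and>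
        distributed M lborel (\<lambda>\<omega>. (X \<omega> 1, X \<omega> 2, Y \<omega> 1, Y \<omega> 2)) dens \<and>
        distributed N lborel (\<lambda>\<omega>. (X' \<omega> 1, X' \<omega> 2, Y' \<omega> 1, Y' \<omega> 2)) dens_star
        \<longrightarrow>
        distr M (euclidean_borel 2) X = distr N (euclidean_borel 2) X' \<and>
        distr M (euclidean_borel 2) Y = distr N (euclidean_borel 2) Y' \<and>
        distr M borel (\<lambda>\<omega>. X \<omega> 1) = distr M borel (\<lambda>\<omega>. X \<omega> 2) \<and>
        distr M borel (\<lambda>\<omega>. Y \<omega> 1) = distr M borel (\<lambda>\<omega>. Y \<omega> 2) \<and>
        concordance_le 2 M X Y N X' Y' \<and>
        \<P>(\<omega> in M. ordinal_pattern 2 (X \<omega>) = ordinal_pattern 2 (Y \<omega>)) = 1 \<and>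
        \<P>(\<omega> in N. ordinal_pattern 2 (X' \<omega>) = ordinal_pattern 2 (Y' \<omega>)) = 1 / 2 \<and>
        opd 2 M X Y > opd 2 N X' Y') \<and>
     \<not> (\<forall>(M :: ((real \<times> real \<times> real \<times> real) \<times> (real \<times> real \<times> real \<times> real)) measure) X Y X' Y'.
        prob_space M \<and>
        random_vector 2 M X \<and> random_vector 2 M Y \<and>
        random_vector 2 M X' \<and> random_vector 2 M Y' \<and>
        distr M (euclidean_borel 2) X = distr M (euclidean_borel 2) X' \<and>
        distr M (euclidean_borel 2) Y = distr M (euclidean_borel 2) Y' \<and>
        concordance_le 2 M X Y M X' Y'
        \<longrightarrow> opd 2 M X Y \<le> opd 2 M X' Y')"
proof (intro conjI)
  show "prob_space (density lborel dens)" "prob_space (density lborel dens_star)"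
    by (fact prob_space_dens prob_space_dens_star)+
next
  have m: "(\<lambda>z. ennreal (dens z)) \<in> borel_measurable borel"
    "(\<lambda>z. ennreal (dens_star z)) \<in> borel_measurable borel"
    unfolding dens_eq dens_star_eq by (rule emeasure_block_density(1)[where P = UNIV and Q = UNIV]; auto)+
  obtain M :: "((real \<times> real \<times> real \<times> real) \<times> (real \<times> real \<times> real \<times> real)) measure" and X Y X' Y'
  where MXY: "prob_space M" "random_vector 2 M X" "random_vector 2 M Y"
    "random_vector 2 M X'" "random_vector 2 M Y'"
    "distributed M lborel (\<lambda>\<omega>. (X \<omega> 1, X \<omega> 2, Y \<omega> 1, Y \<omega> 2)) dens"
    "distributed M lborel (\<lambda>\<omega>. (X' \<omega> 1, X' \<omega> 2, Y' \<omega> 1, Y' \<omega> 2)) dens_star"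
    by (rule ex_independent_pair[OF prob_space_dens m(1) prob_space_dens_star m(2)])
  show "\<not> (\<forall>(M :: ((real \<times> real \<times> real \<times> real) \<times> (real \<times> real \<times> real \<times> real)) measure) X Y X' Y'.
        prob_space M \<and>
        random_vector 2 M X \<and> random_vector 2 M Y \<and>
        random_vector 2 M X' \<and> random_vector 2 M Y' \<and>
        distr M (euclidean_borel 2) X = distr M (euclidean_borel 2) X' \<and>
        distr M (euclidean_borel 2) Y = distr M (euclidean_borel 2) Y' \<and>
        concordance_le 2 M X Y M X' Y'
        \<longrightarrow> opd 2 M X Y \<le> opd 2 M X' Y')"
    \<comment> \<open>Both measures of \<open>opd_counterexample\<close> are taken to be the product
      space \<open>M\<close>.\<close>
    using opd_counterexample[OF MXY(1-3,1,4-7)] MXY(1-5) by (meson not_less)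
qed (use opd_counterexample in blast)

end
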